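(* Let $f(z)$ be a meromorphic function in $\mathbb{C}$ having three (distinct) Picard exceptional values for the varying-steps difference operator with vanishing period. Then $f(z)$ is a constant.
   Context: For $\eta\in\mathbb{C}\setminus\{0\}$, $\Delta_\eta f(z):=f(z+\eta)-f(z)$. For $a\in\mathbb{C}$, $n_{\Delta_\eta}(r,1/(f-a))$ is the number of common zeros of $f-a$ and $\Delta_\eta f$ in $|z|\le r$, each counted with the minimum of its multiplicities as a zero of $f-a$ and of $\Delta_\eta f$ (a zero of an identically vanishing function having infinite multiplicity). $n_{\Delta_\eta}(r,f)$ is the number of common zeros of $1/f$ and $\Delta_\eta(1/f)$ in $|z|\le r$, each counted with the minimum of the two multiplicities. For $g=f$ or $g=1/(f-a)$, $$N_{\Delta_\eta}(r,g):=\int_0^r\frac{n_{\Delta_\eta}(t,g)-n_{\Delta_\eta}(0,g)}{t}\,dt+n_{\Delta_\eta}(0,g)\log r,\qquad \widetilde N_{\Delta_\eta}(r,g):=N(r,g)-N_{\Delta_\eta}(r,g),$$ with $N(r,g)$ the Nevanlinna integrated counting function of poles. A value $a\in\widehat{\mathbb{C}}=\mathbb{C}\cup\{\infty\}$ is a Picard exceptional value for the varying-steps difference operator with vanishing period of $f$ if there is a sequence of nonzero $\eta_n\to0$ as $n\to\infty$ such that $\widetilde N_{\Delta_{\eta_n}}(r,1/(f-a))=O(1)$ (as $r\to\infty$, for each $n$), where for $a=\infty$ the expression $1/(f-a)$ is replaced by $f$. *)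

theory Defs
  imports "HOL-Complex_Analysis.Complex_Analysis" "HOL-Library.Extended_Nat"
    "HOL-Library.Landau_Symbols"
begin

datatype extended_complex = Finite complex | Infty

definition diff_op :: "complex \<Rightarrow> (complex \<Rightarrow> complex) \<Rightarrow> complex \<Rightarrow> complex" where
  "diff_op \<eta> f z = f (z + \<eta>) - f z"

(* Multiplicity of z as a zero of the meromorphic function h: 0 if z is not a zero (in particular
   at poles, where zorder is negative), and infinite if h vanishes identically. By the identity
   theorem it is enough to test vanishing near z; values at isolated points are irrelevant. *)
definition zero_mult :: "(complex \<Rightarrow> complex) \<Rightarrow> complex \<Rightarrow> enat" where
  "zero_mult h z =
     (if \<forall>\<^sub>F w in at z. h w = 0 then \<infinity> else enat (nat (zorder h z)))"

(* If h is meromorphic on the plane and not identically zero, the minimum below is finite at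
   every point and the index set is finite, so neither the_enat nor the sum takes a junk value. *)
definition n_common_zeros ::
    "(complex \<Rightarrow> complex) \<Rightarrow> (complex \<Rightarrow> complex) \<Rightarrow> real \<Rightarrow> nat" where
  "n_common_zeros h k r =
     (\<Sum>z | norm z \<le> r \<and> zero_mult h z > 0 \<and> zero_mult k z > 0.
        the_enat (min (zero_mult h z) (zero_mult k z)))"

definition n_poles :: "(complex \<Rightarrow> complex) \<Rightarrow> real \<Rightarrow> nat" where
  "n_poles g r = (\<Sum>z | norm z \<le> r \<and> is_pole g z. nat (- zorder g z))"

definition integrated_count :: "(real \<Rightarrow> nat) \<Rightarrow> real \<Rightarrow> real" where
  "integrated_count n r =
     integral {0..r} (\<lambda>t. (real (n t) - real (n 0)) / t) + real (n 0) * ln r"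

(* In the following functions the value a stands for the argument 1/(f - a), and Infty for the
   argument f, of the counting functions of Nevanlinna theory. *)
fun n_diff :: "complex \<Rightarrow> (complex \<Rightarrow> complex) \<Rightarrow> extended_complex \<Rightarrow> real \<Rightarrow> nat" where
  "n_diff \<eta> f (Finite a) = n_common_zeros (\<lambda>z. f z - a) (diff_op \<eta> f)"
| "n_diff \<eta> f Infty = n_common_zeros (\<lambda>z. 1 / f z) (diff_op \<eta> (\<lambda>z. 1 / f z))"

fun n_value :: "(complex \<Rightarrow> complex) \<Rightarrow> extended_complex \<Rightarrow> real \<Rightarrow> nat" where
  "n_value f (Finite a) = n_poles (\<lambda>z. 1 / (f z - a))"
| "n_value f Infty = n_poles f"

definition N_diff :: "complex \<Rightarrow> (complex \<Rightarrow> complex) \<Rightarrow> extended_complex \<Rightarrow> real \<Rightarrow> real" where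
  "N_diff \<eta> f a r = integrated_count (n_diff \<eta> f a) r"

definition N_value :: "(complex \<Rightarrow> complex) \<Rightarrow> extended_complex \<Rightarrow> real \<Rightarrow> real" where
  "N_value f a r = integrated_count (n_value f a) r"

definition N_tilde :: "complex \<Rightarrow> (complex \<Rightarrow> complex) \<Rightarrow> extended_complex \<Rightarrow> real \<Rightarrow> real" where
  "N_tilde \<eta> f a r = N_value f a r - N_diff \<eta> f a r"

definition picard_exceptional_vanishing_period ::
    "(complex \<Rightarrow> complex) \<Rightarrow> extended_complex \<Rightarrow> bool" where
  "picard_exceptional_vanishing_period f a \<longleftrightarrow>
     (\<exists>\<eta> :: nat \<Rightarrow> complex. (\<forall>n. \<eta> n \<noteq> 0) \<and> \<eta> \<longlonglongrightarrow> 0 \<and>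
        (\<forall>n. N_tilde (\<eta> n) f a \<in> O[at_top](\<lambda>_. 1)))"

end

(* A counting function that is not identically 0 has an integrated version growing at least like
   log r, so N~ = O(1) forces the two counting functions to agree: every a-point z0 is also a zero
   of f(z + eta) - f(z), so z0 + eta_n is an a-point for every n. As eta_n tends to 0, these
   accumulate at z0 unless f has no a-points at all. Hence f omits three values, and the little
   Picard theorem applies to the entire function 1/(f - a) for an omitted finite value a. *)
theory Submission
  imports Defs
begin

section \<open>Counting functions and the growth of their integrated versions\<close>

text \<open>Constancy just to the right of 0 keeps the integrand of \<open>integrated_count\<close>
  bounded there despite the factor 1/t.\<close>

definition counting_function :: "(real \<Rightarrow> nat) \<Rightarrow> bool" where
  "counting_function n \<longleftrightarrow> mono n \<and> (\<forall>\<^sub>F t in at_right 0. n t = n 0)"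

text \<open>Only finitely many points lie in the unit ball, so a small enough disc contains none of
  them except possibly the origin.\<close>

lemma counting_function_sum:
  fixes Z :: "'a::real_normed_vector set"
  assumes fin: "\<And>r. finite {z \<in> Z. norm z \<le> r}"
  shows "counting_function (\<lambda>r. \<Sum>z\<in>{z \<in> Z. norm z \<le> r}. m z)"
  unfolding counting_function_def
proof
  show "mono (\<lambda>r. \<Sum>z\<in>{z \<in> Z. norm z \<le> r}. m z)"
    using fin by (intro monoI sum_mono2) auto
  have "\<forall>z\<in>{z \<in> Z. norm z \<le> 1} - {0}. \<forall>\<^sub>F t in at_right 0. t < norm z"
    by (auto intro!: order_tendstoD(2)[OF tendsto_ident_at])
  hence "\<forall>\<^sub>F t in at_right 0. \<forall>z\<in>{z \<in> Z. norm z \<le> 1} - {0}. t < norm z"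
    by (intro eventually_ball_finite) (use fin in auto)
  moreover have "\<forall>\<^sub>F t in at_right (0::real). t < 1" "\<forall>\<^sub>F t in at_right (0::real). t > 0"
    by (auto simp: eventually_at_right_field intro: exI[of _ 1])
  ultimately show "\<forall>\<^sub>F t in at_right 0. (\<Sum>z\<in>{z \<in> Z. norm z \<le> t}. m z)
                     = (\<Sum>z\<in>{z \<in> Z. norm z \<le> 0}. m z)"
  proof eventually_elim
    case (elim t)
    have "{z \<in> Z. norm z \<le> t} = {z \<in> Z. norm z \<le> 0}"
    proof (intro equalityI subsetI)
      fix z assume z: "z \<in> {z \<in> Z. norm z \<le> t}"
      show "z \<in> {z \<in> Z. norm z \<le> 0}"
      proof (rule ccontr)
        assume "z \<notin> {z \<in> Z. norm z \<le> 0}"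
        hence "z \<in> {z \<in> Z. norm z \<le> 1} - {0}"
          using z elim by auto
        thus False
          using z elim by force
      qed
    qed (use elim in auto)
    thus ?case by simp
  qed
qed

text \<open>Monotonicity gives measurability. The integrand vanishes on (0, e), where
  \<open>n\<close> still equals \<open>n 0\<close>, and is at most \<open>n r / e\<close> from e
  on.\<close>

lemma counting_function_integrable:
  assumes "counting_function n"
  shows "(\<lambda>t. (real (n t) - real (n 0)) / t) integrable_on {0..r}"
proof -
  have mono: "mono n" using assms by (simp add: counting_function_def)
  obtain e where e: "e > 0" "\<And>t. 0 < t \<Longrightarrow> t < e \<Longrightarrow> n t = n 0"
    using assms by (auto simp: counting_function_def eventually_at_right_field)
  have "(\<lambda>t. real (n t)) \<in> borel_measurable borel"
    using mono by (intro borel_measurable_mono) (auto simp: mono_def)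
  hence "(\<lambda>t. (real (n t) - real (n 0)) / t) \<in> borel_measurable borel"
    by measurable
  hence meas: "(\<lambda>t. (real (n t) - real (n 0)) / t) \<in> borel_measurable (lebesgue_on {0..r})"
    by (intro measurable_restrict_space1 measurable_completion) simp
  show ?thesis
  proof (rule measurable_bounded_by_integrable_imp_integrable[OF meas])
    show "(\<lambda>t::real. real (n r) / e) integrable_on {0..r}"
      by (rule integrable_const_ivl)
    fix t assume t: "t \<in> {0..r}"
    hence nt: "n 0 \<le> n t" "n t \<le> n r"
      using mono by (auto simp: mono_def)
    show "norm ((real (n t) - real (n 0)) / t) \<le> real (n r) / e"
    proof (cases "t = 0 \<or> t < e")
      case True
      \<comment> \<open>At t = 0 the quotient is 0 by the convention for division by zero.\<close>
      thus ?thesis using e t by (cases "t = 0") auto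
    next
      case False
      thus ?thesis using e t nt by (auto intro!: frac_le)
    qed
  qed auto
qed

lemma integrated_count_add:
  assumes "counting_function n" "counting_function m"
  shows "integrated_count (\<lambda>t. n t + m t) r = integrated_count n r + integrated_count m r"
proof -
  have "integral {0..r} (\<lambda>t. (real (n t + m t) - real (n 0 + m 0)) / t) =
        integral {0..r} (\<lambda>t. (real (n t) - real (n 0)) / t + (real (m t) - real (m 0)) / t)"
    by (intro Henstock_Kurzweil_Integration.integral_cong) (simp add: field_simps flip: add_divide_distrib)
  also have "\<dots> = integral {0..r} (\<lambda>t. (real (n t) - real (n 0)) / t) +
                  integral {0..r} (\<lambda>t. (real (m t) - real (m 0)) / t)"
    using assms by (intro Henstock_Kurzweil_Integration.integral_add counting_function_integrable)
  finally show ?thesis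
    by (simp add: integrated_count_def algebra_simps)
qed

text \<open>If \<open>n 0\<close> is positive, the term \<open>n 0 * ln r\<close> suffices;
  otherwise the integrand dominates 1/t from s on, which gives \<open>ln r - ln s\<close>. The
  absolute value lets one bound serve both cases.\<close>

lemma integrated_count_ge:
  assumes n: "counting_function n" and s: "0 < s" "1 \<le> n s" and r: "s \<le> r"
    and "0 \<le> ln r"
  shows "ln r - \<bar>ln s\<bar> \<le> integrated_count n r"
proof -
  have mono: "mono n" using n by (simp add: counting_function_def)
  define F where "F = (\<lambda>t. (real (n t) - real (n 0)) / t)"
  have int: "F integrable_on {0..r}"
    unfolding F_def by (rule counting_function_integrable[OF n])
  have nonneg: "0 \<le> F t" if "0 \<le> t" for t
    using monoD[OF mono that] that by (simp add: F_def)
  show ?thesis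
  proof (cases "n 0 = 0")
    case False
    have "0 \<le> integral {0..r} F"
      by (intro Henstock_Kurzweil_Integration.integral_nonneg int) (auto intro: nonneg)
    moreover have "1 * ln r \<le> real (n 0) * ln r"
      using False \<open>0 \<le> ln r\<close> by (intro mult_right_mono) auto
    ultimately show ?thesis
      by (simp add: integrated_count_def F_def)
  next
    case True
    have "((\<lambda>t. 1 / t) has_integral (ln r - ln s)) {s..r}"
      using s r by (intro fundamental_theorem_of_calculus)
        (auto intro!: derivative_eq_intros simp flip: has_real_derivative_iff_has_vector_derivative)
    hence int': "(\<lambda>t. 1 / t) integrable_on {s..r}"
      and "ln r - ln s = integral {s..r} (\<lambda>t. 1 / t)"
      by (auto simp: integral_unique has_integral_integrable)
    note this(2)
    also have "integral {s..r} (\<lambda>t. 1 / t) \<le> integral {s..r} F"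
    proof (rule integral_le)
      show "F integrable_on {s..r}"
        by (rule integrable_on_subinterval[OF int]) (use s in auto)
      fix t assume t: "t \<in> {s..r}"
      hence "1 \<le> n t" using s monoD[OF mono, of s t] by simp
      thus "1 / t \<le> F t"
        using t s True by (auto simp: F_def intro!: divide_right_mono)
    qed (fact int')
    also have "\<dots> \<le> integral {0..r} F"
      by (intro integral_subset_le int integrable_on_subinterval[OF int])
        (use s in \<open>auto intro: nonneg\<close>)
    finally show ?thesis
      using True by (simp add: integrated_count_def F_def)
  qed
qed

lemma integrated_count_bounded_imp_zero:
  assumes n: "counting_function n" and O: "integrated_count n \<in> O[at_top](\<lambda>_. 1)"
  shows "n s = 0"
proof (rule ccontr)
  assume "n s \<noteq> 0"
  \<comment> \<open>The radius s may be nonpositive, while the logarithmic lower bound requires a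
    positive one.\<close>
  define s' where "s' = max s 1"
  have "n s \<le> n s'"
    using n by (auto simp: counting_function_def s'_def intro: monoD)
  hence s': "0 < s'" "1 \<le> n s'"
    using \<open>n s \<noteq> 0\<close> by (auto simp: s'_def)
  obtain C where "\<forall>\<^sub>F r in at_top. norm (integrated_count n r) \<le> C"
    using O by (auto elim!: landau_o.bigE)
  moreover have "\<forall>\<^sub>F r in at_top. ln r > C + \<bar>ln s'\<bar>"
    using ln_at_top by (simp add: filterlim_at_top_dense)
  moreover have "\<forall>\<^sub>F r in at_top. r \<ge> s'" "\<forall>\<^sub>F r in at_top. r \<ge> (1::real)"
    by (rule eventually_ge_at_top)+
  ultimately have "\<forall>\<^sub>F r::real in at_top. False"
  proof eventually_elim
    case (elim r)
    have "ln r - \<bar>ln s'\<bar> \<le> integrated_count n r"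
      using elim by (intro integrated_count_ge n s') auto
    thus ?case using elim by simp
  qed
  thus False by simp
qed

section \<open>Zeros of meromorphic functions, their multiplicities and shifts\<close>

text \<open>Zeros are poles of the reciprocal, whose singularities cannot accumulate in a compact
  disc.\<close>

lemma finite_isolated_zeros:
  assumes "h meromorphic_on UNIV"
  shows "finite {z. norm z \<le> r \<and> isolated_zero h z}"
proof -
  have mero: "(\<lambda>z. inverse (h z)) meromorphic_on UNIV"
    using assms by (intro meromorphic_intros)
  have "finite (cball 0 r \<inter> {z. \<not> (\<lambda>z. inverse (h z)) analytic_on {z}})"
    by (intro finite_not_islimpt_in_compact meromorphic_on_imp_not_islimpt_singularities[OF mero]) auto
  moreover have "{z. norm z \<le> r \<and> isolated_zero h z}
      \<subseteq> cball 0 r \<inter> {z. \<not> (\<lambda>z. inverse (h z)) analytic_on {z}}"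
    using analytic_at_imp_no_pole is_pole_inverse_iff[of h] by auto
  ultimately show ?thesis by (rule rev_finite_subset)
qed

text \<open>Stated as a limit because values at single points are irrelevant to
  \<open>zero_mult\<close>. Infinite multiplicity is included, as it occurs when a difference
  vanishes identically.\<close>

lemma zero_mult_pos_imp_tendsto_0:
  assumes "h meromorphic_on {z}" "zero_mult h z > 0"
  shows "h \<midarrow>z\<rightarrow> 0"
proof (cases "\<forall>\<^sub>F w in at z. h w = 0")
  case True
  thus ?thesis by (rule tendsto_eventually)
next
  case False
  hence "zorder h z > 0"
    using assms(2) by (simp add: zero_mult_def zero_enat_def)
  moreover have "\<forall>\<^sub>F w in at z. h w \<noteq> 0"
    using False assms(1) not_essential_frequently_0_imp_eventually_0
    by (auto simp: meromorphic_at_iff frequently_def)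
  ultimately have "isolated_zero h z"
    using assms(1) zorder_pos_imp_isolated_zero by blast
  thus ?thesis by (simp add: isolated_zero_def)
qed

text \<open>The two counts differ by a sum of nonnegative deficits, multiplicity in h minus the
  minimum of the two. This sum is itself a counting function, so a bounded integrated version forces
  every deficit to be 0.\<close>

lemma zero_mult_pos_if_counts_agree:
  assumes h: "h meromorphic_on UNIV" and nz: "\<And>z. \<forall>\<^sub>F w in at z. h w \<noteq> 0"
    and O: "(\<lambda>r. integrated_count (n_poles (\<lambda>z. 1 / h z)) r - integrated_count (n_common_zeros h k) r)
             \<in> O[at_top](\<lambda>_. 1)"
    and z: "isolated_zero h z"
  shows "zero_mult k z > 0"
proof -
  have mero: "h meromorphic_on {z}" for z
    using h meromorphic_on_subset by blast
  have freq: "\<exists>\<^sub>F w in at z. h w \<noteq> 0" for z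
    using nz by (simp add: eventually_frequently)
  define Z where "Z = {z. isolated_zero h z}"
  have zm: "zero_mult h z = enat (nat (zorder h z))" for z
    using nz[of z] freq[of z] by (auto simp: zero_mult_def frequently_def)
  have Z_iff: "z \<in> Z \<longleftrightarrow> zorder h z > 0" for z
    using mero nz zorder_pos_imp_isolated_zero zorder_isolated_zero_pos'[of h z]
    by (auto simp: Z_def meromorphic_at_iff)
  have [simp]: "the_enat 0 = 0"
    by (simp add: zero_enat_def)
  have pos: "zero_mult h z > 0 \<longleftrightarrow> z \<in> Z" for z
    by (simp add: Z_iff zm zero_enat_def)
  define m where "m = (\<lambda>z. nat (zorder h z))"
  define m2 where "m2 = (\<lambda>z. the_enat (min (zero_mult h z) (zero_mult k z)))"
  define n2 where "n2 = (\<lambda>r. \<Sum>z\<in>{z \<in> Z. norm z \<le> r}. m2 z)"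
  define d where "d = (\<lambda>r. \<Sum>z\<in>{z \<in> Z. norm z \<le> r}. m z - m2 z)"
  have fin: "finite {z \<in> Z. norm z \<le> r}" for r
    using finite_isolated_zeros[OF h, of r] by (simp add: Z_def conj_commute)
  \<comment> \<open>The subtraction in \<open>d\<close> is truncated; this bound ensures that
    \<open>n2\<close> and \<open>d\<close> add up to the full count of zeros.\<close>
  have le: "m2 z \<le> m z" for z
    by (cases "zero_mult k z") (auto simp: m2_def m_def zm min_def)
  have "n_poles (\<lambda>z. 1 / h z) r = n2 r + d r" for r
  proof -
    have "zorder (\<lambda>z. 1 / h z) z = - zorder h z" for z
      using zorder_inverse[of h z] mero freq
      by (simp add: meromorphic_at_iff divide_inverse)
    moreover have "is_pole (\<lambda>z. 1 / h z) z \<longleftrightarrow> z \<in> Z" for z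
      using is_pole_inverse_iff[of h z] by (simp add: divide_inverse Z_def)
    ultimately have "n_poles (\<lambda>z. 1 / h z) r = (\<Sum>z\<in>{z \<in> Z. norm z \<le> r}. m z)"
      by (simp add: n_poles_def m_def conj_commute)
    thus ?thesis
      using le by (simp add: n2_def d_def flip: sum.distrib)
  qed
  hence poles: "n_poles (\<lambda>z. 1 / h z) = (\<lambda>r. n2 r + d r)" by blast
  have common: "n_common_zeros h k = n2"
  proof
    fix r
    show "n_common_zeros h k r = n2 r"
      unfolding n_common_zeros_def n2_def m2_def
    \<comment> \<open>Points of \<open>Z\<close> that are not zeros of k contribute
      \<open>the_enat 0 = 0\<close>, so the index set may be enlarged to all zeros of h.\<close>
    proof (rule sum.mono_neutral_cong_left)
      show "{z. norm z \<le> r \<and> 0 < zero_mult h z \<and> 0 < zero_mult k z} \<subseteq> {z \<in> Z. norm z \<le> r}"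
        by (auto simp flip: pos)
    qed (use fin in \<open>auto simp: pos\<close>)
  qed
  have cf: "counting_function n2" "counting_function d"
    unfolding n2_def d_def by (intro counting_function_sum fin)+
  have "integrated_count d \<in> O[at_top](\<lambda>_. 1)"
    using O by (simp add: poles common integrated_count_add[OF cf])
  hence "d (norm z) = 0"
    by (rule integrated_count_bounded_imp_zero[OF cf(2)])
  moreover have zZ: "z \<in> Z" using z by (simp add: Z_def)
  ultimately have "m z \<le> m2 z"
    using fin by (auto simp: d_def)
  moreover have "m z > 0" using zZ by (simp add: Z_iff m_def)
  ultimately show ?thesis
    by (cases "zero_mult k z = 0") (auto simp: m2_def)
qed

text \<open>Adding h to its difference shows that h tends to 0 at each \<open>z + \<eta> n\<close>.
  These points converge to z, but h is analytic and nonzero on a punctured neighbourhood of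
  z.\<close>

lemma no_isolated_zero_if_shift_invariant:
  assumes h: "h meromorphic_on UNIV" and nz: "\<And>z. \<forall>\<^sub>F w in at z. h w \<noteq> 0"
    and eta: "\<And>n. \<eta> n \<noteq> 0" "\<eta> \<longlonglongrightarrow> 0"
    and shift: "\<And>n. isolated_zero h z \<Longrightarrow> zero_mult (diff_op (\<eta> n) h) z > 0"
  shows "\<not> isolated_zero h z"
proof
  assume z: "isolated_zero h z"
  have mero: "h meromorphic_on {z}" for z
    using h meromorphic_on_subset by blast
  have lim: "h \<midarrow>z + \<eta> n\<rightarrow> 0" for n
  proof -
    have "(\<lambda>w. h (w + \<eta> n)) meromorphic_on {z}"
      by (intro meromorphic_on_compose[OF h] analytic_intros) auto
    hence "diff_op (\<eta> n) h meromorphic_on {z}"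
      unfolding diff_op_def by (intro meromorphic_intros mero)
    hence "diff_op (\<eta> n) h \<midarrow>z\<rightarrow> 0"
      using shift[OF z] by (rule zero_mult_pos_imp_tendsto_0)
    hence "(\<lambda>w. diff_op (\<eta> n) h w + h w) \<midarrow>z\<rightarrow> 0 + 0"
      using z by (intro tendsto_add) (auto simp: isolated_zero_def)
    hence "(\<lambda>w. h (w + \<eta> n)) \<midarrow>z\<rightarrow> 0"
      by (simp add: diff_op_def)
    thus ?thesis
      by (subst (asm) at_to_0, subst at_to_0) (simp add: filterlim_filtermap add_ac)
  qed
  have "\<forall>\<^sub>F w in at z. h analytic_on {w}"
    using isolated_singularity_at_altdef mero[of z] by (auto simp: meromorphic_at_iff)
  hence "\<forall>\<^sub>F w in at z. h analytic_on {w} \<and> h w \<noteq> 0"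
    using nz[of z] by eventually_elim auto
  moreover have "filterlim (\<lambda>n. z + \<eta> n) (at z) sequentially"
    using eta by (auto simp: filterlim_at intro!: tendsto_eq_intros)
  ultimately have "\<forall>\<^sub>F n in sequentially. h analytic_on {z + \<eta> n} \<and> h (z + \<eta> n) \<noteq> 0"
    by (rule eventually_compose_filterlim)
  then obtain n where n: "h analytic_on {z + \<eta> n}" "h (z + \<eta> n) \<noteq> 0"
    by (auto simp: eventually_sequentially)
  \<comment> \<open>Analyticity turns the limit at the shifted point into the value there, which is
    nonzero.\<close>
  have "h \<midarrow>z + \<eta> n\<rightarrow> h (z + \<eta> n)"
    using analytic_at_imp_isCont[OF n(1)] by (simp add: isCont_def)
  with lim[of n] n(2) show False
    using LIM_unique by blast
qed

section \<open>Exceptional values as omitted values\<close>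

text \<open>The zeros of this function are the points where f takes the given value, so finite and
  infinite values can be treated alike.\<close>

fun value_fun :: "(complex \<Rightarrow> complex) \<Rightarrow> extended_complex \<Rightarrow> complex \<Rightarrow> complex" where
  "value_fun f (Finite a) = (\<lambda>z. f z - a)"
| "value_fun f Infty = (\<lambda>z. 1 / f z)"

lemma N_tilde_value_fun:
  "N_tilde \<eta> f a r = integrated_count (n_poles (\<lambda>z. 1 / value_fun f a z)) r
     - integrated_count (n_common_zeros (value_fun f a) (diff_op \<eta> (value_fun f a))) r"
proof (cases a)
  case (Finite x)
  have "diff_op \<eta> (\<lambda>z. f z - x) = diff_op \<eta> f"
    by (simp add: diff_op_def fun_eq_iff)
  thus ?thesis
    by (simp add: N_tilde_def N_value_def N_diff_def Finite integrated_count_def)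
qed (simp add: N_tilde_def N_value_def N_diff_def integrated_count_def)

text \<open>This is the identity theorem; nice meromorphy prescribes the values at singular points,
  so equality near one point spreads to the whole plane.\<close>

lemma eventually_neq_if_not_constant:
  assumes "f nicely_meromorphic_on UNIV" "\<not> f constant_on UNIV"
  shows "\<forall>\<^sub>F w in at z. f w \<noteq> c"
proof (rule ccontr)
  assume "\<not> (\<forall>\<^sub>F w in at z. f w \<noteq> c)"
  hence "\<exists>\<^sub>F w in at z. f w = c" by (simp add: frequently_def)
  from frequently_eq_meromorphic_imp_constant[OF this assms(1)] have "f w = c" for w
    by auto
  thus False using assms(2) by (auto simp: constant_on_def)
qed

lemma exceptional_value_omitted:
  assumes f: "f nicely_meromorphic_on UNIV" "\<not> f constant_on UNIV"
    and a: "picard_exceptional_vanishing_period f a"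
  shows "\<not> isolated_zero (value_fun f a) z"
proof -
  obtain \<eta> where eta: "\<And>n. \<eta> n \<noteq> 0" "\<eta> \<longlonglongrightarrow> 0"
    "\<And>n. N_tilde (\<eta> n) f a \<in> O[at_top](\<lambda>_. 1)"
    using a unfolding picard_exceptional_vanishing_period_def by blast
  have "f meromorphic_on UNIV"
    using f by (simp add: nicely_meromorphic_on_def)
  hence h: "value_fun f a meromorphic_on UNIV"
    by (cases a) (auto intro!: meromorphic_intros)
  \<comment> \<open>For \<open>Infty\<close> the claim amounts to f being nonzero, since 1 / 0 =
    0.\<close>
  have nz: "\<forall>\<^sub>F w in at z. value_fun f a w \<noteq> 0" for z
    using eventually_neq_if_not_constant[OF f] by (cases a) auto
  have "zero_mult (diff_op (\<eta> n) (value_fun f a)) z > 0" if "isolated_zero (value_fun f a) z" for n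
    using eta(3)[of n] that unfolding N_tilde_value_fun[abs_def]
    by (rule zero_mult_pos_if_counts_agree[OF h nz])
  thus ?thesis
    by (rule no_isolated_zero_if_shift_invariant[OF h nz eta(1,2)])
qed

section \<open>Reduction to the little Picard theorem\<close>

text \<open>The Moebius map w -> 1/(w - a) sends the omitted value a to infinity, making the image
  of f entire, and sends b and c to two distinct finite values that the image omits.\<close>

lemma constant_if_three_values_omitted:
  assumes f: "f nicely_meromorphic_on UNIV"
    and ab: "Finite a \<noteq> b" and ac: "Finite a \<noteq> c" and bc: "b \<noteq> c"
    and omit: "\<And>x z. x \<in> {Finite a, b, c} \<Longrightarrow> \<not> isolated_zero (value_fun f x) z"
  shows "f constant_on UNIV"
proof (rule ccontr)
  assume nconst: "\<not> f constant_on UNIV"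
  note neq = eventually_neq_if_not_constant[OF f nconst]
  have mero: "f meromorphic_on UNIV"
    using f by (simp add: nicely_meromorphic_on_def)
  \<comment> \<open>At poles of f the reciprocal has removable singularities, which are filled in
    here.\<close>
  define g where "g = remove_sings (\<lambda>z. inverse (f z - a))"
  have mero': "(\<lambda>z. inverse (f z - a)) meromorphic_on UNIV"
    using mero by (intro meromorphic_intros)
  have ev: "\<forall>\<^sub>F w in at z. g w = inverse (f w - a)" for z
    unfolding g_def using meromorphic_on_subset[OF mero', of "{z}"]
    by (intro eventually_remove_sings_eq_at) (auto simp: meromorphic_at_iff)
  have nopole: "\<not> is_pole g z" for z
    using omit[of "Finite a" z] is_pole_cong[OF ev refl, of z] is_pole_inverse_iff[of "\<lambda>z. f z - a" z]
    by simp
  have "g nicely_meromorphic_on UNIV"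
    unfolding g_def by (rule remove_sings_nicely_meromorphic[OF mero'])
  hence an: "g analytic_on {z}" for z
    using nicely_meromorphic_on_imp_analytic_at nopole by blast
  hence "g analytic_on UNIV"
    using analytic_on_analytic_at by blast
  hence holo: "g holomorphic_on UNIV"
    by (rule analytic_imp_holomorphic)
  \<comment> \<open>The images of b and c under the Moebius map, with infinity going to 0.\<close>
  define v where "v = (\<lambda>x. case x of Finite y \<Rightarrow> inverse (y - a) | Infty \<Rightarrow> 0)"
  have avoid: "g z \<noteq> v x" if x: "x \<in> {b, c}" for x z
  proof
    assume "g z = v x"
    hence "g \<midarrow>z\<rightarrow> v x"
      using analytic_at_imp_isCont[OF an[of z]] by (simp add: isCont_def)
    hence lim: "(\<lambda>w. inverse (f w - a)) \<midarrow>z\<rightarrow> v x"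
      using tendsto_cong[OF ev] by blast
    have "isolated_zero (value_fun f x) z"
    proof (cases x)
      case (Finite y)
      hence "y \<noteq> a" using x ab ac by auto
      \<comment> \<open>Inverting the map, which is possible since \<open>v x\<close> is nonzero,
        shows that f tends to y at z.\<close>
      hence "(\<lambda>w. inverse (inverse (f w - a)) - (y - a)) \<midarrow>z\<rightarrow> inverse (v x) - (y - a)"
        by (intro tendsto_intros lim) (simp add: v_def Finite)
      thus ?thesis
        using neq[where c = y] by (simp add: Finite v_def isolated_zero_def)
    next
      case Infty
      have "isolated_zero (\<lambda>w. inverse (f w - a)) z"
        using lim neq[where c = a] by (simp add: Infty v_def isolated_zero_def)
      hence "is_pole (\<lambda>w. f w - a) z"
        by (simp add: isolated_zero_inverse_iff)
      hence "is_pole (\<lambda>w. (f w - a) + a) z"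
        unfolding is_pole_def by (intro tendsto_add_filterlim_at_infinity'[OF _ tendsto_const])
      thus ?thesis
        using isolated_zero_inverse_iff[of f z] by (simp add: Infty divide_inverse)
    qed
    thus False using omit x by blast
  qed
  have "v b \<noteq> v c"
    using ab ac bc by (auto simp: v_def split: extended_complex.splits)
  moreover have "range g \<inter> {v b, v c} = {}"
    using avoid by (auto simp: image_iff) (metis avoid insertCI)+
  ultimately obtain k where k: "g = (\<lambda>_. k)"
    using little_Picard[OF holo] by blast
  \<comment> \<open>A constant g makes f equal to \<open>a + inverse k\<close> near 0. This includes
    k = 0, where \<open>inverse 0 = 0\<close> gives the value a.\<close>
  have "\<forall>\<^sub>F w in at (0::complex). False"
    using ev[of 0] neq[where c = "a + inverse k" and z = 0] 
  proof eventually_elim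
    case (elim w)
    hence "inverse k = f w - a"
      by (simp add: k)
    thus ?case using elim by simp
  qed
  thus False by simp
qed

theorem theorem4p7:
  fixes f :: "complex \<Rightarrow> complex" and a b c :: extended_complex
  assumes "f nicely_meromorphic_on UNIV"
    and "a \<noteq> b" and "a \<noteq> c" and "b \<noteq> c"
    and "picard_exceptional_vanishing_period f a"
    and "picard_exceptional_vanishing_period f b"
    and "picard_exceptional_vanishing_period f c"
  shows "f constant_on UNIV"
proof (rule ccontr)
  assume nconst: "\<not> f constant_on UNIV"
  note omitted = exceptional_value_omitted[OF assms(1) nconst]
  show False
  proof (cases a)
    case (Finite x)
    have "f constant_on UNIV"
      by (rule constant_if_three_values_omitted[of f x b c])
        (use assms Finite omitted in auto)
    with nconst show False ..
  next
    case Infty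
    \<comment> \<open>At most one of the distinct values is infinite, so b can take over the role of
      the finite value.\<close>
    then obtain y where y: "b = Finite y"
      using assms(2) by (cases b) auto
    have "f constant_on UNIV"
      by (rule constant_if_three_values_omitted[of f y a c])
        (use assms y omitted in auto)
    with nconst show False ..
  qed
qed

end
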